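(* Let $G=(V,E)$ be a finite simple undirected graph of order $n\ge 1$ and maximum degree $\Delta$. Then $\kappa(G)=\frac{n\Delta}{\Delta+1}$ if and only if $G$ has a perfect code $C$ such that every $v\in C$ has degree $d(v)=\Delta$.
   Context: For a graph $G=(V,E)$ and $C\subseteq V$, let $Odd(C)=\{v\in V : |N(v)\cap C|\equiv 1 \pmod 2\}$, where $N(v)$ is the open neighborhood of $v$. A set $B\subseteq V$ is a weak odd dominated (WOD) set if there exists $C\subseteq V\setminus B$ with $B\subseteq Odd(C)$. $\kappa(G)$ is the maximum size of a WOD set of $G$. A perfect code of $G$ is a set $C\subseteq V$ such that $C$ is an independent set and every vertex in $V\setminus C$ has exactly one neighbor in $C$. *)

theory Defs
  imports Complex_Main "Graph_Theory.Pair_Digraph"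
begin

text \<open>A finite simple undirected graph is a \<open>pair_graph\<close>: \<open>pverts G\<close> is a finite vertex set and
  \<open>parcs G\<close> is a symmetric irreflexive relation on it, so an edge \<open>{u, v}\<close> is represented by both
  \<open>(u, v)\<close> and \<open>(v, u)\<close>.\<close>

definition neighborhood :: "'a pair_pre_digraph \<Rightarrow> 'a \<Rightarrow> 'a set" where
  "neighborhood G v = {u \<in> pverts G. (v, u) \<in> parcs G}"

definition degree :: "'a pair_pre_digraph \<Rightarrow> 'a \<Rightarrow> nat" where
  "degree G v = card (neighborhood G v)"

definition max_degree :: "'a pair_pre_digraph \<Rightarrow> nat" where
  "max_degree G = Max (degree G ` pverts G)"

definition odd_nbh :: "'a pair_pre_digraph \<Rightarrow> 'a set \<Rightarrow> 'a set" where
  "odd_nbh G C = {v \<in> pverts G. odd (card (neighborhood G v \<inter> C))}"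

definition wod_set :: "'a pair_pre_digraph \<Rightarrow> 'a set \<Rightarrow> bool" where
  "wod_set G B \<longleftrightarrow> B \<subseteq> pverts G \<and> (\<exists>C. C \<subseteq> pverts G - B \<and> B \<subseteq> odd_nbh G C)"

definition kappa :: "'a pair_pre_digraph \<Rightarrow> nat" where
  "kappa G = Max {card B | B. wod_set G B}"

definition independent_set :: "'a pair_pre_digraph \<Rightarrow> 'a set \<Rightarrow> bool" where
  "independent_set G C \<longleftrightarrow> C \<subseteq> pverts G \<and> (\<forall>u \<in> C. \<forall>v \<in> C. (u, v) \<notin> parcs G)"

definition perfect_code :: "'a pair_pre_digraph \<Rightarrow> 'a set \<Rightarrow> bool" where
  "perfect_code G C \<longleftrightarrow>
     independent_set G C \<and> (\<forall>v \<in> pverts G - C. \<exists>!u. u \<in> neighborhood G v \<and> u \<in> C)"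

text \<open>The degree agrees with the library's out-degree (and, by symmetry, in-degree), and the maximum
  defining \<open>kappa\<close> is taken over a finite nonempty set.\<close>

lemma (in pair_wf_digraph) degree_eq_out_degree: "degree G v = out_degree (with_proj G) v"
proof -
  have "out_arcs (with_proj G) v = Pair v ` neighborhood G v"
    by (auto simp: out_arcs_def neighborhood_def dest: in_arcsD2)
  then show ?thesis
    by (simp add: degree_def out_degree_def card_image inj_on_def)
qed

lemma wod_set_empty: "wod_set G {}"
  by (auto simp: wod_set_def)

lemma kappa_set_finite_nonempty:
  assumes "finite (pverts G)"
  shows "finite {card B | B. wod_set G B}" and "{card B | B. wod_set G B} \<noteq> {}"
proof -
  have "{card B | B. wod_set G B} \<subseteq> card ` Pow (pverts G)"
    by (auto simp: wod_set_def)
  then show "finite {card B | B. wod_set G B}"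
    by (rule finite_subset) (simp add: assms)
  show "{card B | B. wod_set G B} \<noteq> {}"
    using wod_set_empty[of G] by blast
qed

end

theory Submission
  imports Defs
begin

text \<open>For a WOD set \<open>B\<close> with complement \<open>D\<close>, every vertex of \<open>B\<close> has a neighbor in \<open>D\<close>, so counting
  the edges between \<open>B\<close> and \<open>D\<close> gives
  \<open>|B| \<le> (\<Sum>b\<in>B. |N(b) \<inter> D|) = (\<Sum>c\<in>D. |N(c) \<inter> B|) \<le> (\<Sum>c\<in>D. d(c)) \<le> \<Delta> |D| = \<Delta> (n - |B|)\<close>,
  that is, \<open>|B| (\<Delta> + 1) \<le> n \<Delta>\<close>. Equality throughout says exactly that \<open>D\<close> is a perfect code
  all of whose vertices have degree \<open>\<Delta>\<close>.\<close>

lemma finite_neighborhood: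
  assumes "pair_graph G"
  shows "finite (neighborhood G v)"
proof -
  interpret pair_graph G by fact
  show ?thesis by (simp add: neighborhood_def)
qed

lemma degree_le_max_degree:
  assumes "finite (pverts G)" "v \<in> pverts G"
  shows "degree G v \<le> max_degree G"
  using assms by (simp add: max_degree_def)

text \<open>Both sides count the pairs in \<open>B\<close> \<times> \<open>C\<close> that are arcs;
  symmetry of \<open>parcs G\<close> lets the neighbors of \<open>c\<close> in \<open>B\<close> be
  read as the \<open>b\<close> with \<open>(b, c)\<close> an arc.\<close>

lemma double_count_edges:
  assumes "pair_graph G" and "B \<subseteq> pverts G" "C \<subseteq> pverts G"
  shows "(\<Sum>b\<in>B. card (neighborhood G b \<inter> C)) = (\<Sum>c\<in>C. card (neighborhood G c \<inter> B))"
proof -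
  interpret pair_graph G by fact
  have fin: "finite B" "finite C"
    using assms(2,3) by (auto intro: finite_subset[OF _ pair_finite_verts])
  have "card (neighborhood G b \<inter> C) = card {c \<in> C. (b, c) \<in> parcs G}" for b
    using assms(3) by (intro arg_cong[where f = card]) (auto simp: neighborhood_def)
  moreover have "card (neighborhood G c \<inter> B) = card {b \<in> B. (b, c) \<in> parcs G}" for c
    using assms(2)
    by (intro arg_cong[where f = card]) (auto simp: neighborhood_def intro: arcs_symmetric)
  ultimately show ?thesis
    using sum_multicount_gen[OF fin, of "\<lambda>b c. (b, c) \<in> parcs G"
        "\<lambda>c. card {b \<in> B. (b, c) \<in> parcs G}"] by simp
qed

text \<open>An odd number is positive, so the witness \<open>C\<close>, which avoids
  \<open>B\<close>, already supplies such a neighbor.\<close>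

lemma wod_set_neighbor_outside:
  assumes "pair_graph G" "wod_set G B" "b \<in> B"
  shows "1 \<le> card (neighborhood G b \<inter> (pverts G - B))"
proof -
  obtain C where C: "C \<subseteq> pverts G - B" "B \<subseteq> odd_nbh G C"
    using assms(2) by (auto simp: wod_set_def)
  have "1 \<le> card (neighborhood G b \<inter> C)"
    using C(2) assms(3) by (auto simp: odd_nbh_def intro: Suc_leI odd_pos)
  also have "\<dots> \<le> card (neighborhood G b \<inter> (pverts G - B))"
    using C(1) finite_neighborhood[OF assms(1)] by (intro card_mono) auto
  finally show ?thesis .
qed

lemma edges_out_le:
  assumes "pair_graph G" "D \<subseteq> pverts G"
  shows "(\<Sum>c\<in>D. card (neighborhood G c \<inter> B)) \<le> (\<Sum>c\<in>D. degree G c)"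
    and "(\<Sum>c\<in>D. degree G c) \<le> max_degree G * card D"
proof -
  interpret pair_graph G by fact
  show "(\<Sum>c\<in>D. card (neighborhood G c \<inter> B)) \<le> (\<Sum>c\<in>D. degree G c)"
    using finite_neighborhood[OF assms(1)]
    by (intro sum_mono) (auto simp: degree_def intro: card_mono)
  have "(\<Sum>c\<in>D. degree G c) \<le> (\<Sum>c\<in>D. max_degree G)"
    using assms(2) by (intro sum_mono degree_le_max_degree) auto
  then show "(\<Sum>c\<in>D. degree G c) \<le> max_degree G * card D"
    by (simp add: mult.commute)
qed

text \<open>Slack in a single term would make the totals differ. This turns each tight link of the
  counting chain into a fact about every vertex.\<close>

lemma sum_eq_imp_eq:
  fixes f g :: "'a \<Rightarrow> nat"
  assumes "finite A" "\<And>x. x \<in> A \<Longrightarrow> f x \<le> g x" "sum g A \<le> sum f A" "x \<in> A"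
  shows "f x = g x"
  by (rule sum_mono_inv[of f A g]) (use assms in \<open>auto intro: antisym sum_mono\<close>)

lemma wod_set_card_le:
  assumes "pair_graph G" "wod_set G B"
  shows "card B \<le> max_degree G * card (pverts G - B)"
proof -
  have B: "B \<subseteq> pverts G" using assms(2) by (simp add: wod_set_def)
  have "card B = (\<Sum>b\<in>B. 1)" by simp
  also have "\<dots> \<le> (\<Sum>b\<in>B. card (neighborhood G b \<inter> (pverts G - B)))"
    by (intro sum_mono wod_set_neighbor_outside[OF assms])
  also have "\<dots> = (\<Sum>c\<in>pverts G - B. card (neighborhood G c \<inter> B))"
    using B by (intro double_count_edges[OF assms(1)]) auto
  also have "\<dots> \<le> (\<Sum>c\<in>pverts G - B. degree G c)"
    by (rule edges_out_le(1)[OF assms(1) Diff_subset])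
  also have "\<dots> \<le> max_degree G * card (pverts G - B)"
    by (rule edges_out_le(2)[OF assms(1) Diff_subset])
  finally show ?thesis .
qed

text \<open>Tightness closes the counting chain into a cycle, so each of its three inequalities is
  an equality of sums and hence holds termwise. The first gives unique neighbors in the complement,
  the second independence, the third full degree.\<close>

lemma wod_set_tight_imp_perfect_code:
  assumes G: "pair_graph G" and wod: "wod_set G B"
    and tight: "card B = max_degree G * card (pverts G - B)"
  shows "perfect_code G (pverts G - B)" and "\<forall>v \<in> pverts G - B. degree G v = max_degree G"
proof -
  interpret pair_graph G by fact
  define D where "D = pverts G - B"
  have B: "B \<subseteq> pverts G" using wod by (simp add: wod_set_def)
  have D: "D \<subseteq> pverts G" by (auto simp: D_def)
  have fin: "finite B" "finite D" using B D by (auto intro: finite_subset[OF _ pair_finite_verts])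
  note le = edges_out_le(1)[OF G D, of B] edges_out_le(2)[OF G D]
  have count: "(\<Sum>b\<in>B. card (neighborhood G b \<inter> D)) = (\<Sum>c\<in>D. card (neighborhood G c \<inter> B))"
    by (rule double_count_edges[OF G B D])
  have ge1: "1 \<le> card (neighborhood G b \<inter> D)" if "b \<in> B" for b
    using wod_set_neighbor_outside[OF G wod that] by (simp add: D_def)
  have tight': "card B = max_degree G * card D" using tight by (simp add: D_def)
  have ge: "card B \<le> (\<Sum>b\<in>B. card (neighborhood G b \<inter> D))"
    using sum_mono[of B "\<lambda>_. 1", OF ge1] by simp
  \<comment> \<open>Going around the cycle: \<Delta>|D| = |B|, which is at most the number of edges
    between \<open>B\<close> and \<open>D\<close>, which is at most the degree sum over
    \<open>D\<close>.\<close>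
  have le_max_deg: "(\<Sum>c\<in>D. max_degree G) \<le> (\<Sum>c\<in>D. degree G c)"
    using le(1) count tight' ge by (simp add: mult.commute)
  have le_card: "(\<Sum>b\<in>B. card (neighborhood G b \<inter> D)) \<le> (\<Sum>b\<in>B. 1)"
    using le count tight' by simp
  have unique: "card (neighborhood G b \<inter> D) = 1" if "b \<in> B" for b
    using sum_eq_imp_eq[of B "\<lambda>_. 1" "\<lambda>b. card (neighborhood G b \<inter> D)" b]
      fin(1) ge1 that le_card by simp
  have deg: "degree G c = max_degree G" if "c \<in> D" for c
    using sum_eq_imp_eq[of D "degree G" "\<lambda>_. max_degree G" c]
      fin(2) D degree_le_max_degree[OF pair_finite_verts] that le_max_deg by auto
  have "card (neighborhood G c \<inter> B) = degree G c" if "c \<in> D" for c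
  proof (rule sum_eq_imp_eq[OF fin(2) _ _ that])
    show "card (neighborhood G c \<inter> B) \<le> degree G c" for c
      using finite_neighborhood[OF G] by (auto simp: degree_def intro: card_mono)
    show "(\<Sum>c\<in>D. degree G c) \<le> (\<Sum>c\<in>D. card (neighborhood G c \<inter> B))"
      using le(2) count tight' ge by linarith
  qed
  \<comment> \<open>Intersecting the finite neighborhood of \<open>c\<close> with \<open>B\<close>
    loses no elements, so all neighbors of \<open>c\<close> lie in \<open>B\<close> and none in
    \<open>D\<close>.\<close>
  then have nbh: "neighborhood G c \<subseteq> B" if "c \<in> D" for c
    using that card_subset_eq[OF finite_neighborhood[OF G], of "neighborhood G c \<inter> B" c]
    by (auto simp: degree_def)
  have "independent_set G D"
    using nbh D by (fastforce simp: independent_set_def neighborhood_def D_def)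
  moreover have "\<exists>!u. u \<in> neighborhood G v \<and> u \<in> D" if "v \<in> pverts G - D" for v
  proof -
    have "card (neighborhood G v \<inter> D) = 1"
      using unique that by (simp add: D_def)
    then obtain u where "neighborhood G v \<inter> D = {u}"
      by (rule card_1_singletonE)
    then show ?thesis by (metis Int_iff singleton_iff)
  qed
  ultimately show "perfect_code G (pverts G - B)"
    by (simp add: perfect_code_def flip: D_def)
  show "\<forall>v \<in> pverts G - B. degree G v = max_degree G"
    using deg by (simp flip: D_def)
qed

text \<open>The code itself witnesses the WOD property, since one neighbor is an odd number of
  neighbors. The size follows by counting the edges leaving \<open>C\<close>: one per outside
  vertex, \<Delta> per code vertex.\<close>

lemma perfect_code_imp_wod_set_tight:
  assumes G: "pair_graph G" and code: "perfect_code G C"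
    and deg: "\<forall>v \<in> C. degree G v = max_degree G"
  shows "wod_set G (pverts G - C)" and "card (pverts G - C) = max_degree G * card C"
proof -
  have C: "C \<subseteq> pverts G" and indep: "\<And>u v. u \<in> C \<Longrightarrow> v \<in> C \<Longrightarrow> (u, v) \<notin> parcs G"
    using code by (auto simp: perfect_code_def independent_set_def)
  have one: "card (neighborhood G b \<inter> C) = 1" if "b \<in> pverts G - C" for b
  proof -
    have ex1: "\<exists>!u. u \<in> neighborhood G b \<and> u \<in> C"
      using code that by (simp add: perfect_code_def)
    from ex1 obtain u where "u \<in> neighborhood G b \<and> u \<in> C"
      by (rule ex1E)
    with ex1 have "neighborhood G b \<inter> C = {u}" by blast
    then show ?thesis by simp
  qed
  have "pverts G - C \<subseteq> odd_nbh G C"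
    using one by (simp add: odd_nbh_def subset_iff)
  moreover have "C \<subseteq> pverts G - (pverts G - C)" using C by blast
  ultimately show "wod_set G (pverts G - C)"
    unfolding wod_set_def by blast
  \<comment> \<open>Independence is used here: every edge at a code vertex leaves the code.\<close>
  have nbh: "neighborhood G c \<inter> (pverts G - C) = neighborhood G c" if "c \<in> C" for c
    using indep[OF that] by (auto simp: neighborhood_def)
  have "card (pverts G - C) = (\<Sum>b\<in>pverts G - C. card (neighborhood G b \<inter> C))"
    by (simp add: one)
  also have "\<dots> = (\<Sum>c\<in>C. card (neighborhood G c \<inter> (pverts G - C)))"
    using C by (intro double_count_edges[OF G]) auto
  also have "\<dots> = (\<Sum>c\<in>C. max_degree G)"
  proof (rule sum.cong[OF refl])
    show "card (neighborhood G c \<inter> (pverts G - C)) = max_degree G" if "c \<in> C" for c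
      unfolding nbh[OF that] using deg that by (simp add: degree_def)
  qed
  finally show "card (pverts G - C) = max_degree G * card C"
    by (simp add: mult.commute)
qed

lemma kappa_attained:
  assumes "finite (pverts G)"
  obtains B where "wod_set G B" "card B = kappa G"
proof -
  have "kappa G \<in> {card B | B. wod_set G B}"
    unfolding kappa_def by (rule Max_in[OF kappa_set_finite_nonempty[OF assms]])
  then show thesis using that by auto
qed

lemma wod_set_card_le_kappa:
  assumes "finite (pverts G)" "wod_set G B"
  shows "card B \<le> kappa G"
  unfolding kappa_def using assms(2)
  by (intro Max_ge[OF kappa_set_finite_nonempty(1)[OF assms(1)]]) auto

theorem theorem2:
  fixes G :: "'a pair_pre_digraph" and n \<Delta> :: nat
  assumes "pair_graph G"
    and "n = card (pverts G)" and "n \<ge> 1"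
    and "\<Delta> = max_degree G"
  shows "real (kappa G) = real n * real \<Delta> / (real \<Delta> + 1) \<longleftrightarrow>
         (\<exists>C. perfect_code G C \<and> (\<forall>v \<in> C. degree G v = \<Delta>))"
proof -
  interpret pair_graph G by fact
  have fin: "finite (pverts G)" by simp
  \<comment> \<open>A maximum WOD set serves both directions: its size eliminates \<open>n\<close>,
    and its complement is the code to be produced.\<close>
  obtain B where B: "wod_set G B" "card B = kappa G"
    using kappa_attained[OF fin] .
  have sub: "B \<subseteq> pverts G" using B(1) by (simp add: wod_set_def)
  then have n: "n = kappa G + card (pverts G - B)"
    using B(2) assms(2) card_Int_Diff[OF fin, of B] by (simp add: Int_absorb1)
  have "real \<Delta> + 1 \<noteq> 0" by linarith
  then have "real (kappa G) = real n * real \<Delta> / (real \<Delta> + 1) \<longleftrightarrow>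
        real (kappa G * (\<Delta> + 1)) = real (n * \<Delta>)"
    by (simp only: nonzero_eq_divide_eq of_nat_mult of_nat_add of_nat_1 not_False_eq_True)
  also have "\<dots> \<longleftrightarrow> kappa G * (\<Delta> + 1) = n * \<Delta>"
    by (rule of_nat_eq_iff)
  \<comment> \<open>Substituting \<open>n\<close> and cancelling \<open>kappa G * \<Delta>\<close>
    leaves exactly the equality case of \<open>wod_set_card_le\<close> for \<open>B\<close>.\<close>
  also have "\<dots> \<longleftrightarrow> kappa G = \<Delta> * card (pverts G - B)"
    by (simp add: n algebra_simps)
  also have "\<dots> \<longleftrightarrow> (\<exists>C. perfect_code G C \<and> (\<forall>v \<in> C. degree G v = \<Delta>))"
  proof
    assume "kappa G = \<Delta> * card (pverts G - B)"
    then show "\<exists>C. perfect_code G C \<and> (\<forall>v \<in> C. degree G v = \<Delta>)"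
      using wod_set_tight_imp_perfect_code[OF assms(1) B(1)] B(2) assms(4) by auto
  next
    assume "\<exists>C. perfect_code G C \<and> (\<forall>v \<in> C. degree G v = \<Delta>)"
    then obtain C where C: "perfect_code G C" "\<forall>v \<in> C. degree G v = max_degree G"
      using assms(4) by auto
    \<comment> \<open>The complement of \<open>C\<close> need not be \<open>B\<close>, so its
      tightness is carried over to \<open>B\<close> by comparing sizes.\<close>
    note tight = perfect_code_imp_wod_set_tight[OF assms(1) C]
    have "C \<subseteq> pverts G" using C(1) by (simp add: perfect_code_def independent_set_def)
    then have "n = card (pverts G - C) + card C"
      using assms(2) card_Int_Diff[OF fin, of C] by (simp add: Int_absorb1)
    moreover have "card (pverts G - C) \<le> kappa G"
      by (rule wod_set_card_le_kappa[OF fin tight(1)])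
    \<comment> \<open>A larger WOD set has a smaller complement; both splittings of the vertex set
      add up to \<open>n\<close>.\<close>
    ultimately have "card (pverts G - B) \<le> card C" using n by simp
    then have "\<Delta> * card (pverts G - B) \<le> \<Delta> * card C"
      by (rule mult_le_mono2)
    also have "\<dots> \<le> kappa G"
      using tight(2) \<open>card (pverts G - C) \<le> kappa G\<close> assms(4) by simp
    \<comment> \<open>The general bound for \<open>B\<close> is the reverse inequality.\<close>
    finally show "kappa G = \<Delta> * card (pverts G - B)"
      using wod_set_card_le[OF assms(1) B(1)] B(2) assms(4) by simp
  qed
  finally show ?thesis .
qed

end
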